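(* Let $J\ge 2$, with all indices in $\{1,\dots,J\}$ understood modulo $J$. Suppose that the functions $\beta_j:\mathbb{R}_+^2\to\mathbb{R}_+$, $1\le j\le J$, are continuous and non-decreasing, and that there exists $z^{(0)}\in\mathbb{R}_+^J$ such that, coordinate by coordinate, $$z^{(0)}\le\Phi(z^{(0)}),\qquad z^{(0)}\le\Phi(\Phi(z^{(0)})),\qquad \Phi(z^{(0)})<\infty,$$ where $\Phi(z)=\big(\phi_j(z_{j-1}+z_j,\;z_j+z_{j+1})\big)_{1\le j\le J}$. Then there exists a unique solution $u\in\mathbb{R}_+^J$ of the fixed point equation $$u_j=\phi_{j-1}(u_{j-1},u_j)+\phi_j(u_j,u_{j+1}),\qquad 1\le j\le J.$$
   Context: Ring network with $J$ nodes and $J$ classes of connections, class $j$ using exactly the two nodes $j$ and $j+1$ (modulo $J$). $\mathbb{R}_+=[0,\infty)$. For each class $j$ there are constants $p_j\ge 0$ with $\sum_j p_j=1$, $a_j\ge 0$, $r_j\in(0,1)$, and a function $\beta_j:\mathbb{R}_+^2\to\mathbb{R}_+$. Set $$\alpha_j=p_j\sqrt{\frac{2}{\pi}}\left(\prod_{n=1}^{\infty}\frac{1-r_j^{2n}}{1-r_j^{2n-1}}\right)\sqrt{a_j},\qquad \phi_j(s_1,s_2)=\frac{\alpha_j}{\sqrt{\beta_j(s_1,s_2)}},$$ with the convention $\phi_j=+\infty$ where $\beta_j=0$. "Non-decreasing" means non-decreasing with respect to the coordinatewise partial order; inequalities between vectors are coordinatewise. *)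

theory Defs
  imports "HOL-Analysis.Analysis" "Berlekamp_Zassenhaus.Finite_Field"
begin

text \<open>
  The indices modulo \<open>J\<close> are the elements of \<open>'J mod_ring\<close>, the ring of integers modulo
  \<open>CARD('J)\<close>, so \<open>j - 1\<close> and \<open>j + 1\<close> are the cyclic neighbours of \<open>j\<close>.
  The class \<open>nontriv\<close> says exactly that \<open>CARD('J) > 1\<close>; hence a free type variable
  \<open>'J::nontriv\<close> stands for an arbitrary \<open>J \<ge> 2\<close>, and \<open>real ^ 'J mod_ring\<close> for the
  \<open>J\<close>-dimensional real space.
\<close>

definition alpha :: "real \<Rightarrow> real \<Rightarrow> real \<Rightarrow> real" where
  "alpha p a r =
     p * sqrt (2 / pi) *
     (\<Prod>n. (1 - r ^ (2 * Suc n)) / (1 - r ^ (2 * Suc n - 1))) * sqrt a"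

text \<open>
  The value is infinite wherever \<open>\<beta>\<close> vanishes, even if \<open>\<alpha> = 0\<close>.
\<close>

definition phi :: "real \<Rightarrow> (real \<times> real \<Rightarrow> real) \<Rightarrow> real \<times> real \<Rightarrow> ereal" where
  "phi \<alpha> \<beta> s = (if \<beta> s = 0 then \<infinity> else ereal (\<alpha> / sqrt (\<beta> s)))"

definition Phi ::
  "('J::nontriv mod_ring \<Rightarrow> real) \<Rightarrow> ('J mod_ring \<Rightarrow> real \<times> real \<Rightarrow> real) \<Rightarrow>
   real ^ 'J mod_ring \<Rightarrow> ereal ^ 'J mod_ring" where
  "Phi \<alpha> \<beta> z = (\<chi> j. phi (\<alpha> j) (\<beta> j) (z $ (j - 1) + z $ j, z $ j + z $ (j + 1)))"

text \<open>
  The map \<open>Phi\<close> takes real vectors. To apply it a second time, a vector with finite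
  coordinates is read back as a real one; \<open>real_vec\<close> is meaningful only on such vectors,
  since \<open>real_of_ereal\<close> sends infinite values to \<open>0\<close>.
\<close>

definition real_vec :: "ereal ^ 'n \<Rightarrow> real ^ 'n" where
  "real_vec w = (\<chi> i. real_of_ereal (w $ i))"

end

theory Submission
  imports Defs
begin

text \<open>
  Put \<open>z\<^sub>j = \<phi>\<^sub>j(u\<^sub>j, u\<^sub>j\<^sub>+\<^sub>1)\<close>. Then \<open>u\<^sub>j = z\<^sub>j\<^sub>-\<^sub>1 + z\<^sub>j\<close>, and \<open>u\<close> solves the equation iff
  \<open>z = \<Phi>(z)\<close>. As \<open>\<phi>\<^sub>j\<close> is non-increasing, \<open>\<Phi>\<close> is antitone, so the hypotheses say that \<open>\<Phi>\<close>
  maps the box between \<open>z\<^sup>(\<^sup>0\<^sup>)\<close> and \<open>\<Phi>(z\<^sup>(\<^sup>0\<^sup>))\<close> into itself; \<open>\<Phi>\<close> is finite and continuous there,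
  and Brouwer's theorem gives a fixed point. For uniqueness, let \<open>d\<close> be the difference of two
  fixed points. If \<open>d\<^sub>j \<noteq> 0\<close>, antitonicity of \<open>\<phi>\<^sub>j\<close> forces one of \<open>d\<^sub>j\<^sub>-\<^sub>1 + d\<^sub>j\<close>, \<open>d\<^sub>j + d\<^sub>j\<^sub>+\<^sub>1\<close>
  to have the sign opposite to \<open>d\<^sub>j\<close>, so a neighbour of \<open>j\<close> has a strictly larger \<open>\<bar>d\<bar>\<close>; this
  is impossible where \<open>\<bar>d\<bar>\<close> is maximal.
\<close>

text \<open>With \<open>x = r ^ (2 * n + 1)\<close>, a factor differs from 1 by
  \<open>x * ((1 - r) / (1 - x))\<close>, which is at most \<open>x\<close> because
  \<open>x \<le> r\<close>; a geometric series then dominates. Convergence is what lets the infinite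
  product in \<open>alpha\<close> inherit the sign of its factors.\<close>

lemma convergent_prod_alpha:
  fixes r :: real
  assumes r: "0 < r" "r < 1"
  shows "convergent_prod (\<lambda>n. (1 - r ^ (2 * Suc n)) / (1 - r ^ (2 * Suc n - 1)))"
    (is "convergent_prod ?f")
proof (rule abs_convergent_prod_imp_convergent_prod, rule summable_imp_abs_convergent_prod,
    rule summable_comparison_test')
  show "summable (\<lambda>n. r ^ n)"
    using r by (simp add: summable_geometric)
  fix n :: nat
  define x where "x = r ^ (2 * n + 1)"
  have x: "0 \<le> x" "x \<le> r"
    using power_decreasing[of 1 "2 * n + 1" r] r by (simp_all add: x_def)
  have "?f n - 1 = (1 - r * x) / (1 - x) - 1"
    by (simp add: x_def)
  also have "\<dots> = x * ((1 - r) / (1 - x))"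
    using x r by (simp add: field_simps)
  also have "\<bar>\<dots>\<bar> \<le> x * 1"
    unfolding abs_mult using x r by (intro mult_mono) auto
  also have "\<dots> \<le> r ^ n"
    using r power_decreasing[of n "2 * n + 1" r] by (simp add: x_def)
  finally show "norm (norm (?f n - 1)) \<le> r ^ n"
    by simp
qed

lemma alpha_nonneg:
  assumes "0 \<le> p" "0 \<le> a" "0 < r" "r < 1"
  shows "0 \<le> alpha p a r"
proof -
  have "0 \<le> (\<Prod>n. (1 - r ^ (2 * Suc n)) / (1 - r ^ (2 * Suc n - 1)))"
    using assms
    by (intro has_prod_nonneg[OF convergent_prod_has_prod[OF convergent_prod_alpha]]
        divide_nonneg_nonneg)
      (simp_all add: power_le_one del: power_Suc mult_Suc_right)
  then show ?thesis
    using assms unfolding alpha_def by (intro mult_nonneg_nonneg) auto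
qed

lemma phi_nonneg: "0 \<le> \<alpha> \<Longrightarrow> 0 \<le> \<beta> s \<Longrightarrow> 0 \<le> phi \<alpha> \<beta> s"
  by (simp add: phi_def)

lemma phi_antimono:
  assumes "0 \<le> \<alpha>" "0 \<le> \<beta> s" "\<beta> s \<le> \<beta> t"
  shows "phi \<alpha> \<beta> t \<le> phi \<alpha> \<beta> s"
  using assms by (auto simp: phi_def intro!: divide_left_mono)

lemma phi_finite_pos: "phi \<alpha> \<beta> s < \<infinity> \<Longrightarrow> 0 \<le> \<beta> s \<Longrightarrow> 0 < \<beta> s"
  by (auto simp: phi_def order.order_iff_strict split: if_splits)

text \<open>The maximality argument for uniqueness, freed from \<open>phi\<close>: the hypotheses
  keep only the sign information that antitonicity gives about two fixed points.\<close>

lemma cyclic_antitone_unique: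
  fixes z w :: "'a::{finite, ring_1} \<Rightarrow> real"
  assumes zw: "\<And>j. z (j - 1) + z j \<le> w (j - 1) + w j \<Longrightarrow> z j + z (j + 1) \<le> w j + w (j + 1)
                \<Longrightarrow> w j \<le> z j"
    and wz: "\<And>j. w (j - 1) + w j \<le> z (j - 1) + z j \<Longrightarrow> w j + w (j + 1) \<le> z j + z (j + 1)
                \<Longrightarrow> z j \<le> w j"
  shows "z = w"
proof -
  let ?d = "\<lambda>j. \<bar>z j - w j\<bar>"
  have "Max (range ?d) \<in> range ?d"
    by (rule Max_in) simp_all
  then obtain j where "Max (range ?d) = ?d j"
    by (rule imageE)
  then have j: "?d i \<le> ?d j" for i
    using Max_ge[of "range ?d" "?d i"] by simp
  have "z j = w j"
    using zw[of j] wz[of j] j[of "j - 1"] j[of "j + 1"] by argo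
  then show ?thesis
    using j by fastforce
qed

theorem proposition5:
  fixes p a r \<alpha> :: "'J::nontriv mod_ring \<Rightarrow> real"
    and \<beta> :: "'J mod_ring \<Rightarrow> real \<times> real \<Rightarrow> real"
    and z0 :: "real ^ 'J mod_ring"
  assumes p_nonneg: "\<And>j. 0 \<le> p j"
    and p_sum: "(\<Sum>j\<in>UNIV. p j) = 1"
    and a_nonneg: "\<And>j. 0 \<le> a j"
    and r_range: "\<And>j. 0 < r j \<and> r j < 1"
    and alpha_eq: "\<And>j. \<alpha> j = alpha (p j) (a j) (r j)"
    and beta_nonneg: "\<And>j s. s \<in> {0..} \<times> {0..} \<Longrightarrow> 0 \<le> \<beta> j s"
    and beta_cont: "\<And>j. continuous_on ({0..} \<times> {0..}) (\<beta> j)"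
    and beta_mono: "\<And>j s1 s2 t1 t2. \<lbrakk>0 \<le> s1; s1 \<le> t1; 0 \<le> s2; s2 \<le> t2\<rbrakk>
                      \<Longrightarrow> \<beta> j (s1, s2) \<le> \<beta> j (t1, t2)"
    and z0_nonneg: "\<And>j. 0 \<le> z0 $ j"
    and z0_le_Phi: "\<And>j. ereal (z0 $ j) \<le> Phi \<alpha> \<beta> z0 $ j"
    and z0_le_Phi_Phi: "\<And>j. ereal (z0 $ j) \<le> Phi \<alpha> \<beta> (real_vec (Phi \<alpha> \<beta> z0)) $ j"
    and Phi_z0_finite: "\<And>j. Phi \<alpha> \<beta> z0 $ j < \<infinity>"
  shows "\<exists>!u :: real ^ 'J mod_ring.
           (\<forall>j. 0 \<le> u $ j) \<and>
           (\<forall>j. ereal (u $ j) =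
                 phi (\<alpha> (j - 1)) (\<beta> (j - 1)) (u $ (j - 1), u $ j) +
                 phi (\<alpha> j) (\<beta> j) (u $ j, u $ (j + 1)))"
proof -
  have alpha_nn: "0 \<le> \<alpha> j" for j
    using alpha_nonneg p_nonneg a_nonneg r_range alpha_eq by simp
  have phi_nn: "0 \<le> phi (\<alpha> j) (\<beta> j) (x, y)" if "0 \<le> x" "0 \<le> y" for j x y
    using that by (simp add: phi_nonneg alpha_nn beta_nonneg)
  have phi_anti: "phi (\<alpha> j) (\<beta> j) (x', y') \<le> phi (\<alpha> j) (\<beta> j) (x, y)"
    if "0 \<le> x" "x \<le> x'" "0 \<le> y" "y \<le> y'" for j x x' y y'
    using that by (intro phi_antimono alpha_nn beta_nonneg beta_mono) auto
  have Phi_anti: "Phi \<alpha> \<beta> w $ j \<le> Phi \<alpha> \<beta> z $ j"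
    if "\<And>j. 0 \<le> z $ j" "\<And>j. z $ j \<le> w $ j" for z w j
    using that by (auto simp: Phi_def intro!: phi_anti add_mono)

  define w0 where "w0 = real_vec (Phi \<alpha> \<beta> z0)"
  \<comment> \<open>The default value 0 of \<open>real_vec\<close> at infinity never enters on the
    box, since \<open>Phi\<close> is finite there.\<close>
  define F where "F z = real_vec (Phi \<alpha> \<beta> z)" for z
  have nn: "0 \<le> z $ j" if "z \<in> cbox z0 w0" for z j
    using that z0_nonneg[of j] by (auto simp: mem_box_cart intro: order_trans)
  have Phi_fin: "Phi \<alpha> \<beta> z $ j < \<infinity>" if "z \<in> cbox z0 w0" for z j
    using Phi_anti[of z0 z j] Phi_z0_finite[of j] that z0_nonneg
    by (auto simp: mem_box_cart intro: le_less_trans)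
  have Phi_nn: "0 \<le> Phi \<alpha> \<beta> z $ j" if "\<And>j. 0 \<le> z $ j" for z j
    using that by (auto simp: Phi_def intro!: phi_nn)
  have F_eq: "ereal (F z $ j) = Phi \<alpha> \<beta> z $ j" if "z \<in> cbox z0 w0" for z j
    using Phi_fin[OF that, of j] Phi_nn[OF nn[OF that], of j]
    by (cases "Phi \<alpha> \<beta> z $ j") (auto simp: F_def real_vec_def)
  have w0_eq: "ereal (w0 $ j) = Phi \<alpha> \<beta> z0 $ j" for j
    using Phi_z0_finite[of j] Phi_nn[OF z0_nonneg, of j]
    by (cases "Phi \<alpha> \<beta> z0 $ j") (auto simp: w0_def real_vec_def)
  have z0_le: "z0 $ j \<le> w0 $ j" for j
    using z0_le_Phi[of j] w0_eq[of j] by (metis ereal_less_eq(3))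
  have F_maps: "F \<in> cbox z0 w0 \<rightarrow> cbox z0 w0"
  proof (rule Pi_I)
    fix z assume z: "z \<in> cbox z0 w0"
    \<comment> \<open>Antitonicity swaps the corners: the lower bound comes from the value at
      \<open>w0\<close>, which is the second iterate at \<open>z0\<close>, and the upper bound from
      the value at \<open>z0\<close>.\<close>
    have "ereal (z0 $ j) \<le> ereal (F z $ j)" for j
      using z0_le_Phi_Phi[of j] Phi_anti[OF nn[OF z], of w0 j] z
      by (simp add: F_eq mem_box_cart flip: w0_def)
    moreover have "ereal (F z $ j) \<le> ereal (w0 $ j)" for j
      using Phi_anti[OF z0_nonneg, of z j] z by (simp add: F_eq w0_eq mem_box_cart)
    ultimately show "F z \<in> cbox z0 w0"
      by (simp add: mem_box_cart)
  qed
  \<comment> \<open>Since \<open>phi\<close> is infinite at zeros of \<beta>, finiteness on the box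
    keeps the denominators away from 0, so \<open>F\<close> is there a continuous real
    quotient.\<close>
  have beta_pos: "0 < \<beta> j (z $ (j - 1) + z $ j, z $ j + z $ (j + 1))"
    if "z \<in> cbox z0 w0" for z j
    using Phi_fin[OF that, of j] nn[OF that]
    by (intro phi_finite_pos[of "\<alpha> j"] beta_nonneg) (auto simp: Phi_def)
  have "continuous_on (cbox z0 w0)
      (\<lambda>z. \<chi> j. \<alpha> j / sqrt (\<beta> j (z $ (j - 1) + z $ j, z $ j + z $ (j + 1))))"
    by (intro continuous_intros continuous_on_compose2[OF beta_cont])
      (use nn beta_pos in \<open>auto simp: less_imp_neq[symmetric]\<close>)
  then have "continuous_on (cbox z0 w0) F"
    by (rule continuous_on_eq)
      (auto simp: F_def real_vec_def Phi_def phi_def vec_eq_iff dest!: beta_pos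
        simp: less_imp_neq[symmetric])
  then obtain z where z: "z \<in> cbox z0 w0" and Fz: "F z = z"
    using brouwer[of "cbox z0 w0" F] F_maps z0_le by (auto simp: interval_ne_empty_cart)
  have z_fix: "ereal (z $ j) = phi (\<alpha> j) (\<beta> j) (z $ (j - 1) + z $ j, z $ j + z $ (j + 1))" for j
    using F_eq[OF z, of j] by (simp add: Fz Phi_def)

  let ?sol = "\<lambda>u :: real ^ 'J mod_ring. (\<forall>j. 0 \<le> u $ j) \<and> (\<forall>j. ereal (u $ j) =
      phi (\<alpha> (j - 1)) (\<beta> (j - 1)) (u $ (j - 1), u $ j) + phi (\<alpha> j) (\<beta> j) (u $ j, u $ (j + 1)))"
  \<comment> \<open>This covers every solution, whether or not it arises from the box: two
    nonnegative extended reals with a real sum are both finite, so each \<open>phi\<close> term can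
    be read as a real \<open>v j\<close>.\<close>
  have decompose: "\<exists>v. \<forall>j. u $ j = v (j - 1) + v j \<and> ereal (v j) = phi (\<alpha> j) (\<beta> j) (u $ j, u $ (j + 1))"
    if u: "?sol u" for u
  proof (intro exI allI conjI)
    let ?v = "\<lambda>j. real_of_ereal (phi (\<alpha> j) (\<beta> j) (u $ j, u $ (j + 1)))"
    have "phi (\<alpha> j) (\<beta> j) (u $ j, u $ (j + 1)) \<noteq> \<infinity>" for j
    proof
      assume "phi (\<alpha> j) (\<beta> j) (u $ j, u $ (j + 1)) = \<infinity>"
      moreover have "0 \<le> phi (\<alpha> (j - 1)) (\<beta> (j - 1)) (u $ (j - 1), u $ j)"
        using u by (intro phi_nn) auto
      ultimately show False
        using u by (metis PInfty_neq_ereal(1) plus_ereal.simps(2) ereal_plus_eq_PInfty)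
    qed
    moreover have "0 \<le> phi (\<alpha> j) (\<beta> j) (u $ j, u $ (j + 1))" for j
      using u by (intro phi_nn) auto
    ultimately show v: "ereal (?v j) = phi (\<alpha> j) (\<beta> j) (u $ j, u $ (j + 1))" for j
      by (metis abs_ereal_ge0 ereal_real')
    show "u $ j = ?v (j - 1) + ?v j" for j
    proof -
      have "ereal (u $ j) = ereal (?v (j - 1) + ?v j)"
        using u v[of j] v[of "j - 1"] by (simp flip: plus_ereal.simps)
      then show ?thesis
        by simp
    qed
  qed

  show ?thesis
  proof (rule ex_ex1I)
    show "\<exists>u. ?sol u"
      \<comment> \<open>At this witness, \<open>z_fix\<close> at \<open>j - 1\<close> and at
        \<open>j\<close> identifies the two \<open>phi\<close> terms as \<open>z $ (j - 1)\<close>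
        and \<open>z $ j\<close>.\<close>
      by (rule exI[of _ "\<chi> j. z $ (j - 1) + z $ j"])
        (use nn[OF z] z_fix in \<open>simp flip: plus_ereal.simps\<close>)
  next
    fix u u'
    assume u: "?sol u" and u': "?sol u'"
    obtain v where v: "\<And>j. u $ j = v (j - 1) + v j"
        "\<And>j. ereal (v j) = phi (\<alpha> j) (\<beta> j) (u $ j, u $ (j + 1))"
      using decompose[OF u] by blast
    obtain v' where v': "\<And>j. u' $ j = v' (j - 1) + v' j"
        "\<And>j. ereal (v' j) = phi (\<alpha> j) (\<beta> j) (u' $ j, u' $ (j + 1))"
      using decompose[OF u'] by blast
    have u_nn: "0 \<le> u $ i" and u'_nn: "0 \<le> u' $ i" for i
      using u u' by auto
    have "v = v'"
    proof (rule cyclic_antitone_unique)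
      fix j
      \<comment> \<open>The neighbour sums compared in the lemma are the coordinates
        \<open>j\<close> and \<open>j + 1\<close> of \<open>u\<close> and \<open>u'\<close>, that
        is, the arguments of the \<open>phi\<close> term defining \<open>v j\<close> and
        \<open>v' j\<close>.\<close>
      note sums = v(1)[of j] v(1)[of "j + 1"] v'(1)[of j] v'(1)[of "j + 1"]
      show "v' j \<le> v j"
        if "v (j - 1) + v j \<le> v' (j - 1) + v' j" "v j + v (j + 1) \<le> v' j + v' (j + 1)"
      proof -
        have "ereal (v' j) \<le> ereal (v j)"
          unfolding v(2) v'(2) using that sums by (intro phi_anti u_nn) simp_all
        then show ?thesis by simp
      qed
      show "v j \<le> v' j"
        if "v' (j - 1) + v' j \<le> v (j - 1) + v j" "v' j + v' (j + 1) \<le> v j + v (j + 1)"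
      proof -
        have "ereal (v j) \<le> ereal (v' j)"
          unfolding v(2) v'(2) using that sums by (intro phi_anti u'_nn) simp_all
        then show ?thesis by simp
      qed
    qed
    then show "u = u'"
      by (simp add: vec_eq_iff v(1) v'(1))
  qed
qed

end
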